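(* Let $\hat{A}$ be the normalized adjacency matrix of the ring of cliques $\mathcal{R}_{b,q}$. For $k=0,\dots,\lceil q/2\rceil-1$ (and also for $k=q/2$ if $q$ is even) define $$\alpha_k=2\cos\left(\frac{2\pi k}{q}\right),\qquad \beta_k=\frac12\left(\alpha_k\sqrt{\frac{b-1}{b+1}}-\sqrt{b^2-1}+\sqrt{\frac{b+1}{b-1}}\right),$$ $$\xi_1^{(k)}=\beta_k+\sqrt{\beta_k^2+(b-1)},\qquad \xi_2^{(k)}=\beta_k-\sqrt{\beta_k^2+(b-1)},$$ $$\lambda_1^{(k)}=\frac{\xi_1^{(k)}}{\sqrt{b^2-1}}+1-\frac{1}{b-1},\qquad \lambda_2^{(k)}=\frac{\xi_2^{(k)}}{\sqrt{b^2-1}}+1-\frac1{b-1}.$$ Then $\hat{A}$ has the following eigenpairs. (i) For $k=0$, there are 2 eigenvalues $\lambda_1^{(0)}$ and $\lambda_2^{(0)}$ of $\hat{A}$, each with multiplicity 1, with associated (unnormalized) eigenvectors $$\mathbf{v}_1^{(0)}=\sqrt{b+1}\,(\mathbf{1}_q\otimes\mathbf{e}_1)+\sqrt{b-1}\,(\mathbf{1}_q\otimes\mathbf{g}_1),\qquad \mathbf{v}_2^{(0)}=(b-1)^{3/2}(\mathbf{1}_q\otimes\mathbf{e}_1)-\sqrt{b+1}\,(\mathbf{1}_q\otimes\mathbf{g}_1),$$ respectively. (ii) For each $k=1,\dots,\lceil q/2\rceil-1$, there are 2 eigenvalues $\lambda_1^{(k)}$ and $\lambda_2^{(k)}$ of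 $\hat{A}$, each with multiplicity 2. For each $i\in\{1,2\}$, two independent (unnormalized) eigenvectors associated with $\lambda_i^{(k)}$ are $$\mathbf{v}_{i,1}^{(k)}=\mathbf{c}^{k,q}\otimes(\xi_i^{(k)}\mathbf{e}_1+\mathbf{g}_1)\quad\text{and}\quad \mathbf{v}_{i,2}^{(k)}=\mathbf{s}^{k,q}\otimes(\xi_i^{(k)}\mathbf{e}_1+\mathbf{g}_1).$$ (iii) If $q$ is even, then for $k=q/2$ there are 2 eigenvalues $\lambda_1^{(q/2)}$ and $\lambda_2^{(q/2)}$ of $\hat{A}$, each with multiplicity 1, with associated (unnormalized) eigenvectors $$\mathbf{v}_1^{(q/2)}=\mathbf{c}^{q/2,q}\otimes(\xi_1^{(q/2)}\mathbf{e}_1+\mathbf{g}_1),\qquad \mathbf{v}_2^{(q/2)}=\mathbf{c}^{q/2,q}\otimes(\xi_2^{(q/2)}\mathbf{e}_1+\mathbf{g}_1),$$ respectively. Here, if values of $\lambda_i^{(k)}$ and $\lambda_j^{(l)}$ coincide for $(i,k)\ne(j,l)$, the eigenvalue multiplicities add up.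
   Context: For integers $b\ge 2$, $q\ge 3$, the ring of cliques $\mathcal{R}_{b,q}$ is the graph on $n=bq$ vertices with adjacency matrix $A=I_q\otimes(\mathbf{1}_b\mathbf{1}_b^t-I_b)+C_q\otimes(\mathbf{e}_1\mathbf{e}_1^t)$, i.e. $q$ cliques of size $b$ in which the first vertex of each clique (its corner) is joined to the corners of the two cyclically adjacent cliques; $C_q$ is the adjacency matrix of the $q$-cycle. $D$ is the diagonal degree matrix and $\hat{A}=D^{-1/2}AD^{-1/2}$. $\mathbf{1}_b,\mathbf{1}_q$ are all-ones vectors in $\mathbb{R}^b,\mathbb{R}^q$; $\mathbf{e}_1\in\mathbb{R}^b$ is the first standard basis vector; $\mathbf{g}_1=\mathbf{1}_b-\mathbf{e}_1$. The periodic vectors $\mathbf{c}^{k,q},\mathbf{s}^{k,q}\in\mathbb{R}^q$ have entries $\mathbf{c}^{k,q}_j=\cos(2\pi kj/q)$, $\mathbf{s}^{k,q}_j=\sin(2\pi kj/q)$ for $j=1,\dots,q$. Multiplicities are to be understood with the convention in the last sentence of the claim (coincident values add up).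
   Formalization: When a listed eigenvalue equals -1/(b-1) (e.g. b=q=3, k=1, i=2), its multiplicity is also increased by q(b-2), the multiplicity of the remaining eigenvalue -1/(b-1); the claim as written counts only coincidences among the listed eigenvalues and fails there. *)

theory Defs
  imports Complex_Main "Jordan_Normal_Form.Char_Poly" "Jordan_Normal_Form.VS_Connect"
begin

text \<open>Vectors and matrices are indexed from 0. Vertex \<open>r * b + s\<close> (with \<open>r < q\<close>, \<open>s < b\<close>) is
  the \<open>s\<close>-th vertex of the \<open>r\<close>-th clique, and \<open>s = 0\<close> is the corner of that clique.\<close>

definition kron_mat :: "real mat \<Rightarrow> real mat \<Rightarrow> real mat" where
  "kron_mat A B = mat (dim_row A * dim_row B) (dim_col A * dim_col B)
     (\<lambda>(i, j). A $$ (i div dim_row B, j div dim_col B) * B $$ (i mod dim_row B, j mod dim_col B))"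

definition kron_vec :: "real vec \<Rightarrow> real vec \<Rightarrow> real vec" where
  "kron_vec u v = vec (dim_vec u * dim_vec v) (\<lambda>i. u $ (i div dim_vec v) * v $ (i mod dim_vec v))"

definition outer_mat :: "real vec \<Rightarrow> real vec \<Rightarrow> real mat" where
  "outer_mat u v = mat (dim_vec u) (dim_vec v) (\<lambda>(i, j). u $ i * v $ j)"

definition ones_vec :: "nat \<Rightarrow> real vec" where
  "ones_vec n = vec n (\<lambda>_. 1)"

definition e1 :: "nat \<Rightarrow> real vec" where
  "e1 b = unit_vec b 0"

definition g1 :: "nat \<Rightarrow> real vec" where
  "g1 b = ones_vec b - e1 b"

definition cycle_mat :: "nat \<Rightarrow> real mat" where
  "cycle_mat q = mat q q (\<lambda>(i, j). if j = (i + 1) mod q \<or> i = (j + 1) mod q then 1 else 0)"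

definition ring_adj :: "nat \<Rightarrow> nat \<Rightarrow> real mat" where
  "ring_adj b q = kron_mat (1\<^sub>m q) (outer_mat (ones_vec b) (ones_vec b) - 1\<^sub>m b)
     + kron_mat (cycle_mat q) (outer_mat (e1 b) (e1 b))"

definition degree_of :: "real mat \<Rightarrow> nat \<Rightarrow> real" where
  "degree_of A i = (\<Sum>j<dim_col A. A $$ (i, j))"

definition normalized_adj :: "real mat \<Rightarrow> real mat" where
  "normalized_adj A =
     (let R = mat_diag (dim_row A) (\<lambda>i. 1 / sqrt (degree_of A i)) in R * A * R)"

text \<open>The periodic vectors have entries numbered \<open>1, \<dots>, q\<close>, hence the shift by one.\<close>

definition cos_vec :: "nat \<Rightarrow> nat \<Rightarrow> real vec" where
  "cos_vec k q = vec q (\<lambda>j. cos (2 * pi * real k * real (j + 1) / real q))"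

definition sin_vec :: "nat \<Rightarrow> nat \<Rightarrow> real vec" where
  "sin_vec k q = vec q (\<lambda>j. sin (2 * pi * real k * real (j + 1) / real q))"

definition ring_alpha :: "nat \<Rightarrow> nat \<Rightarrow> real" where
  "ring_alpha q k = 2 * cos (2 * pi * real k / real q)"

definition ring_beta :: "nat \<Rightarrow> nat \<Rightarrow> nat \<Rightarrow> real" where
  "ring_beta b q k = 1 / 2 * (ring_alpha q k * sqrt ((real b - 1) / (real b + 1))
     - sqrt ((real b)\<^sup>2 - 1) + sqrt ((real b + 1) / (real b - 1)))"

text \<open>The index \<open>i\<close> ranges over \<open>{1, 2}\<close>.\<close>

definition ring_xi :: "nat \<Rightarrow> nat \<Rightarrow> nat \<Rightarrow> nat \<Rightarrow> real" where
  "ring_xi b q i k =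
     (if i = 1 then ring_beta b q k + sqrt ((ring_beta b q k)\<^sup>2 + (real b - 1))
      else ring_beta b q k - sqrt ((ring_beta b q k)\<^sup>2 + (real b - 1)))"

definition ring_lambda :: "nat \<Rightarrow> nat \<Rightarrow> nat \<Rightarrow> nat \<Rightarrow> real" where
  "ring_lambda b q i k = ring_xi b q i k / sqrt ((real b)\<^sup>2 - 1) + 1 - 1 / (real b - 1)"

definition ring_evec :: "nat \<Rightarrow> nat \<Rightarrow> nat \<Rightarrow> nat \<Rightarrow> real vec \<Rightarrow> real vec" where
  "ring_evec b q i k u = kron_vec u (ring_xi b q i k \<cdot>\<^sub>v e1 b + g1 b)"

definition mult_of :: "real mat \<Rightarrow> real \<Rightarrow> nat" where
  "mult_of A \<mu> = Polynomial.order \<mu> (char_poly A)"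

text \<open>\<open>added_mult b q m \<mu>\<close> adds up the multiplicities \<open>m k\<close> declared for the eigenvalues
  \<open>ring_lambda b q i k\<close> over all \<open>(i, k)\<close> for which this value is \<open>\<mu>\<close>. The remaining
  \<open>q (b - 2)\<close> eigenvalues are all \<open>- 1 / (b - 1)\<close>, with eigenvectors \<open>u \<otimes> w\<close>, \<open>w\<close> orthogonal to
  \<open>e1\<close> and \<open>g1\<close>; they have to be included in the sum because \<open>ring_lambda b q 2 k = - 1 / (b - 1)\<close>
  whenever \<open>ring_alpha q k = - 2 / (b - 1)\<close>, e.g. for \<open>b = q = 3\<close> and \<open>k = 1\<close>.\<close>

definition modes :: "nat \<Rightarrow> nat set" where
  "modes q = {0..nat \<lceil>real q / 2\<rceil> - 1} \<union> (if even q then {q div 2} else {})"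

definition added_mult :: "nat \<Rightarrow> nat \<Rightarrow> (nat \<Rightarrow> nat) \<Rightarrow> real \<Rightarrow> nat" where
  "added_mult b q m \<mu> =
     (\<Sum>k\<in>modes q. \<Sum>i\<in>{1, 2}. if ring_lambda b q i k = \<mu> then m k else 0)
     + (if \<mu> = - 1 / (real b - 1) then q * (b - 2) else 0)"

definition indep_pair :: "nat \<Rightarrow> real vec \<Rightarrow> real vec \<Rightarrow> bool" where
  "indep_pair n v w \<longleftrightarrow>
     v \<noteq> w \<and> \<not> module.lin_dep class_ring (module_vec TYPE(real) n) {v, w}"

end

theory Submission
  imports Defs
begin

text \<open>If \<open>u\<close> is an eigenvector of the \<open>q\<close>-cycle for the eigenvalue \<open>\<alpha>\<close>, then the normalized adjacency
  matrix acts on \<open>u \<otimes> v\<close> as a \<open>b \<times> b\<close> matrix \<open>mode_mat b \<alpha>\<close> acts on \<open>v\<close>. This matrix preserves the span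
  of \<open>e\<^sub>1\<close> and \<open>g\<^sub>1\<close>, where its eigenvalues are the two roots of a quadratic equation, and it is the
  scalar \<open>- 1 / (b - 1)\<close> on the orthogonal complement.

  For the multiplicities, take for \<open>u\<close> the Hartley vectors \<open>cos + sin\<close>: they diagonalize the cycle over
  the reals, are pairwise orthogonal, and are indexed uniformly by \<open>k < q\<close> (unlike the pairs of
  cosine and sine vectors). Their products with a basis of the clique space are a full eigenbasis
  with an explicit dual basis, which gives the characteristic polynomial; the declared
  multiplicities arise from folding \<open>k\<close> and \<open>q - k\<close> together.\<close>

subsection \<open>Kronecker products\<close>

lemma div_mod_mult_add [simp]:
  fixes b r s :: nat
  assumes "s < b"
  shows "(r * b + s) div b = r" "(r * b + s) mod b = s"
  using assms by auto

lemma mult_add_less: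
  fixes b q r s :: nat
  assumes "r < q" "s < b"
  shows "r * b + s < q * b"
proof -
  have "r * b + s < Suc r * b" using assms by simp
  also have "\<dots> \<le> q * b" using assms by (intro mult_le_mono1) simp
  finally show ?thesis .
qed

lemma div_mod_less:
  fixes b q i :: nat
  assumes "i < q * b"
  shows "i div b < q" "i mod b < b"
proof -
  show "i div b < q" using assms by (simp add: less_mult_imp_div_less)
  have "b > 0" using assms by (cases b) auto
  then show "i mod b < b" by simp
qed

text \<open>A sum over vertices becomes a double sum over cliques and positions inside a clique;
  every Kronecker computation below is decoupled through it.\<close>

lemma sum_div_mod:
  fixes f :: "nat \<Rightarrow> nat \<Rightarrow> 'a::comm_monoid_add"
  shows "(\<Sum>i<q * b. f (i div b) (i mod b)) = (\<Sum>r<q. \<Sum>s<b. f r s)"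
proof -
  have "(\<Sum>i<q * b. f (i div b) (i mod b)) = (\<Sum>r<q. sum (\<lambda>i. f (i div b) (i mod b)) {r * b..<r * b + b})"
    by (rule sum.nat_group[symmetric])
  also have "\<dots> = (\<Sum>r<q. \<Sum>s<b. f r s)"
  proof (rule sum.cong[OF refl])
    fix r
    have "sum (\<lambda>i. f (i div b) (i mod b)) {r * b..<r * b + b} =
        (\<Sum>s<b. f ((r * b + s) div b) ((r * b + s) mod b))"
      using sum.shift_bounds_nat_ivl[of "\<lambda>i. f (i div b) (i mod b)" 0 "r * b" b]
      by (simp add: atLeast0LessThan ac_simps)
    also have "\<dots> = (\<Sum>s<b. f r s)"
      by (intro sum.cong) auto
    finally show "sum (\<lambda>i. f (i div b) (i mod b)) {r * b..<r * b + b} = (\<Sum>s<b. f r s)" .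
  qed
  finally show ?thesis .
qed

lemma dim_kron_vec [simp]: "dim_vec (kron_vec u v) = dim_vec u * dim_vec v"
  by (simp add: kron_vec_def)

lemma scalar_prod_kron_vec:
  assumes "dim_vec u = dim_vec u'" "dim_vec v = dim_vec v'"
  shows "kron_vec u v \<bullet> kron_vec u' v' = (u \<bullet> u') * (v \<bullet> v')"
proof -
  let ?q = "dim_vec u" and ?b = "dim_vec v"
  have "kron_vec u v \<bullet> kron_vec u' v' =
      (\<Sum>i<?q * ?b. (u $ (i div ?b) * v $ (i mod ?b)) * (u' $ (i div ?b) * v' $ (i mod ?b)))"
    using assms by (simp add: scalar_prod_def kron_vec_def atLeast0LessThan)
  also have "\<dots> = (\<Sum>r<?q. \<Sum>s<?b. (u $ r * v $ s) * (u' $ r * v' $ s))"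
    by (rule sum_div_mod)
  also have "\<dots> = (u \<bullet> u') * (v \<bullet> v')"
    using assms by (simp add: scalar_prod_def atLeast0LessThan sum_product ac_simps)
  finally show ?thesis .
qed

subsection \<open>The cycle and the reduction to a single clique\<close>

text \<open>The two terms are the successor and the predecessor on the cycle. The predecessor is
  written with \<open>q - 1\<close> added, since \<open>i - 1\<close> would be truncated at
  \<open>i = 0\<close>.\<close>

lemma sum_cycle_mat:
  assumes "q \<ge> 3" "i < q"
  shows "(\<Sum>j<q. cycle_mat q $$ (i, j) * f j) = f ((i + 1) mod q) + f ((i + (q - 1)) mod q)"
proof -
  let ?a = "(i + 1) mod q" and ?c = "(i + (q - 1)) mod q"
  have a: "?a = (if i = q - 1 then 0 else i + 1)" and c: "?c = (if i = 0 then q - 1 else i - 1)"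
    using assms by (auto simp: mod_if)
  have pred: "i = (j + 1) mod q \<longleftrightarrow> j = ?c" if "j < q" for j
    unfolding c using that assms by (cases "j + 1 = q") auto
  have "(\<Sum>j<q. cycle_mat q $$ (i, j) * f j) =
      (\<Sum>j<q. (if j = ?a then f j else 0) + (if j = ?c then f j else 0))"
  proof (rule sum.cong[OF refl])
    fix j assume "j \<in> {..<q}"
    \<comment> \<open>This needs \<open>q \<ge> 3\<close>: for \<open>q = 2\<close> the two
      neighbours coincide and a single entry 1 would be counted twice on the right.\<close>
    moreover have "?a \<noteq> ?c" unfolding a c using assms by auto
    ultimately show "cycle_mat q $$ (i, j) * f j =
        (if j = ?a then f j else 0) + (if j = ?c then f j else 0)"
      using assms pred[of j] by (auto simp: cycle_mat_def simp del: One_nat_def)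
  qed
  also have "\<dots> = f ?a + f ?c"
    using assms by (simp add: sum.distrib)
  finally show ?thesis .
qed

text \<open>Taking \<open>f\<close> on all naturals turns the cyclic eigenvalue equation into a
  three-term recurrence; periodicity takes care of the wrap-around.\<close>

lemma cycle_mat_eigen:
  assumes q: "q \<ge> 3" and per: "\<And>j. f (j + q) = f j"
    and rec: "\<And>j. f (j + 2) + f j = \<alpha> * f (j + 1)"
  shows "cycle_mat q *\<^sub>v vec q f = \<alpha> \<cdot>\<^sub>v vec q f"
proof (rule eq_vecI)
  have f_mod: "f (j mod q) = f j" for j
  proof (induction j rule: less_induct)
    case (less j)
    show ?case
    proof (cases "j < q")
      case False
      then have "f ((j - q) mod q) = f (j - q)" using less q by simp
      moreover have "f (j - q) = f j" using per[of "j - q"] False by simp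
      ultimately show ?thesis using False by (simp add: le_mod_geq)
    qed simp
  qed
  fix i assume "i < dim_vec (\<alpha> \<cdot>\<^sub>v vec q f)"
  then have i: "i < q" by simp
  have "(cycle_mat q *\<^sub>v vec q f) $ i = (\<Sum>j<q. cycle_mat q $$ (i, j) * f j)"
    using i by (simp add: cycle_mat_def scalar_prod_def atLeast0LessThan)
  also have "\<dots> = f (i + 1) + f (i + (q - 1))"
    using sum_cycle_mat[OF q i] f_mod by simp
  \<comment> \<open>Started at \<open>i + (q - 1)\<close>, the recurrence is centred at
    \<open>i + q\<close>; periodicity removes the surplus \<open>q\<close>.\<close>
  also have "\<dots> = \<alpha> * f i"
    using rec[of "i + (q - 1)"] per[of i] per[of "i + 1"] q by (simp add: ac_simps)
  finally show "(cycle_mat q *\<^sub>v vec q f) $ i = (\<alpha> \<cdot>\<^sub>v vec q f) $ i" using i by simp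
qed (simp add: cycle_mat_def)

text \<open>This is \<open>D^(-1/2) (J - I + \<alpha> e1 e1^t) D^(-1/2)\<close> on one clique, with
  \<open>J\<close> the all-ones matrix and the degrees \<open>b + 1\<close> at the corner and
  \<open>b - 1\<close> elsewhere. The effect of the neighbouring cliques is condensed into
  \<alpha>.\<close>

definition mode_mat :: "nat \<Rightarrow> real \<Rightarrow> real mat" where
  "mode_mat b \<alpha> = mat b b (\<lambda>(s, t).
     ((if s = t then 0 else 1) + (if s = 0 \<and> t = 0 then \<alpha> else 0))
     / (sqrt (if s = 0 then real b + 1 else real b - 1)
        * sqrt (if t = 0 then real b + 1 else real b - 1)))"

section \<open>Entries and degrees of the ring of cliques\<close>

lemma dim_ring_adj [simp]: "dim_row (ring_adj b q) = q * b" "dim_col (ring_adj b q) = q * b"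
  by (simp_all add: ring_adj_def kron_mat_def cycle_mat_def outer_mat_def e1_def ones_vec_def)

lemma ring_adj_index:
  assumes "i < q * b" "j < q * b"
  shows "ring_adj b q $$ (i, j) =
    (if i div b = j div b \<and> i mod b \<noteq> j mod b then 1 else 0)
    + cycle_mat q $$ (i div b, j div b) * (if i mod b = 0 \<and> j mod b = 0 then 1 else 0)"
  using assms div_mod_less[OF assms(1)] div_mod_less[OF assms(2)]
  by (auto simp: ring_adj_def kron_mat_def outer_mat_def e1_def ones_vec_def cycle_mat_def)

lemma degree_of_ring_adj:
  assumes "b \<ge> 2" "q \<ge> 3" "i < q * b"
  shows "degree_of (ring_adj b q) i = (if i mod b = 0 then real b + 1 else real b - 1)"
proof -
  note i = div_mod_less[OF assms(3)]
  let ?r = "i div b" and ?s = "i mod b"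
  have "degree_of (ring_adj b q) i = (\<Sum>j<q * b.
      (if ?r = j div b \<and> ?s \<noteq> j mod b then 1 else 0)
      + cycle_mat q $$ (?r, j div b) * (if ?s = 0 \<and> j mod b = 0 then 1 else 0))"
    unfolding degree_of_def using assms(3) by (intro sum.cong) (auto simp: ring_adj_index)
  also have "\<dots> = (\<Sum>r<q. \<Sum>s<b. (if ?r = r \<and> ?s \<noteq> s then 1 else 0)
      + cycle_mat q $$ (?r, r) * (if ?s = 0 \<and> s = 0 then 1 else 0))"
    by (rule sum_div_mod)
  also have "\<dots> = (\<Sum>r<q. \<Sum>s<b. if ?r = r then (if ?s \<noteq> s then 1 else 0) else 0)
      + (\<Sum>r<q. cycle_mat q $$ (?r, r) * (\<Sum>s<b. if ?s = 0 \<and> s = 0 then 1 else 0))"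
    by (simp only: sum.distrib sum_distrib_left if_if_eq_conj)
  also have "(\<Sum>r<q. \<Sum>s<b. if ?r = r then (if ?s \<noteq> s then 1 else 0) else 0) = real b - 1"
  proof -
    have "(\<Sum>r<q. \<Sum>s<b. if ?r = r then (if ?s \<noteq> s then 1 else 0) else 0) =
        (\<Sum>s<b. if ?s \<noteq> s then 1 else (0::real))"
      using i by (subst sum.swap) simp
    also have "\<dots> = (\<Sum>s<b. 1 - (if ?s = s then 1 else 0))"
      by (intro sum.cong) auto
    also have "\<dots> = real b - 1"
      using i by (simp add: sum_subtractf)
    finally show ?thesis .
  qed
  also have "(\<Sum>r<q. cycle_mat q $$ (?r, r) * (\<Sum>s<b. if ?s = 0 \<and> s = 0 then 1 else 0)) =
      (if ?s = 0 then 2 else 0)"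
    using sum_cycle_mat[OF assms(2) i(1), of "\<lambda>_. 1"] i assms(1) by simp
  finally show ?thesis by simp
qed

lemma normalized_ring_carrier [simp]:
  "normalized_adj (ring_adj b q) \<in> carrier_mat (q * b) (q * b)"
  unfolding normalized_adj_def Let_def by (simp add: mat_diag_def carrier_matI)

lemma normalized_ring_index:
  assumes "i < q * b" "j < q * b"
  shows "normalized_adj (ring_adj b q) $$ (i, j) = ring_adj b q $$ (i, j)
    / (sqrt (degree_of (ring_adj b q) i) * sqrt (degree_of (ring_adj b q) j))"
proof -
  have A: "ring_adj b q \<in> carrier_mat (q * b) (q * b)" by (simp add: carrier_matI)
  show ?thesis
    unfolding normalized_adj_def Let_def
    by (simp add: mat_diag_mult_left[OF A] mat_diag_mult_right[where nr = "q * b" and n = "q * b"] assms)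
qed

text \<open>Degrees depend only on the position inside the clique, so the normalization acts on the
  second factor alone; the first factor meets only the identity and the cycle, which is a scalar on
  \<open>u\<close>.\<close>

lemma normalized_ring_mult_kron_vec:
  assumes b: "b \<ge> 2" and q: "q \<ge> 3" and u: "dim_vec u = q" and v: "dim_vec v = b"
    and cyc: "cycle_mat q *\<^sub>v u = \<alpha> \<cdot>\<^sub>v u"
  shows "normalized_adj (ring_adj b q) *\<^sub>v kron_vec u v = kron_vec u (mode_mat b \<alpha> *\<^sub>v v)"
proof (rule eq_vecI)
  define d where "d s = sqrt (if s = 0 then real b + 1 else real b - 1)" for s :: nat
  show "dim_vec (normalized_adj (ring_adj b q) *\<^sub>v kron_vec u v) =
      dim_vec (kron_vec u (mode_mat b \<alpha> *\<^sub>v v))"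
    using carrier_matD[OF normalized_ring_carrier[of b q]] u by (simp add: mode_mat_def)
  fix i assume "i < dim_vec (kron_vec u (mode_mat b \<alpha> *\<^sub>v v))"
  then have i: "i < q * b" using u by (simp add: mode_mat_def)
  note rs = div_mod_less[OF i]
  let ?r = "i div b" and ?s = "i mod b"
  have cyc_r: "(\<Sum>r<q. cycle_mat q $$ (?r, r) * u $ r) = \<alpha> * u $ ?r"
    using arg_cong[OF cyc, of "\<lambda>w. w $ ?r"] rs u
    by (simp add: scalar_prod_def atLeast0LessThan cycle_mat_def)
  have "(normalized_adj (ring_adj b q) *\<^sub>v kron_vec u v) $ i =
      (\<Sum>j<q * b. normalized_adj (ring_adj b q) $$ (i, j) * kron_vec u v $ j)"
    using i u v carrier_matD[OF normalized_ring_carrier[of b q]]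
    by (simp add: scalar_prod_def atLeast0LessThan)
  also have "\<dots> = (\<Sum>j<q * b.
      ((if ?r = j div b \<and> ?s \<noteq> j mod b then 1 else 0)
        + cycle_mat q $$ (?r, j div b) * (if ?s = 0 \<and> j mod b = 0 then 1 else 0))
      / (d ?s * d (j mod b)) * (u $ (j div b) * v $ (j mod b)))"
    using i u v b q
    by (intro sum.cong)
       (auto simp: normalized_ring_index ring_adj_index degree_of_ring_adj d_def kron_vec_def)
  also have "\<dots> = (\<Sum>r<q. \<Sum>s<b. ((if ?r = r \<and> ?s \<noteq> s then 1 else 0)
        + cycle_mat q $$ (?r, r) * (if ?s = 0 \<and> s = 0 then 1 else 0))
      / (d ?s * d s) * (u $ r * v $ s))"
    by (rule sum_div_mod)
  \<comment> \<open>Summing over the cliques first makes the inner sum contain a row of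
    \<open>cycle_mat q\<close> applied to \<open>u\<close>, to which \<open>cyc_r\<close>
    applies.\<close>
  also have "\<dots> = (\<Sum>s<b. (\<Sum>r<q. ((if ?r = r then (if ?s \<noteq> s then 1 else 0) * u $ r else 0)
        + (if ?s = 0 \<and> s = 0 then 1 else 0) * (cycle_mat q $$ (?r, r) * u $ r)))
      * (v $ s / (d ?s * d s)))"
    by (subst sum.swap, unfold sum_distrib_right, intro sum.cong refl) (auto simp: field_simps)
  also have "\<dots> = (\<Sum>s<b. ((if ?s \<noteq> s then 1 else 0) * u $ ?r
        + (if ?s = 0 \<and> s = 0 then 1 else 0) * (\<alpha> * u $ ?r)) * (v $ s / (d ?s * d s)))"
    using rs cyc_r by (simp add: sum.distrib sum_distrib_left[symmetric] del: mult_cancel_right2)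
  also have "\<dots> = u $ ?r * (\<Sum>s<b. mode_mat b \<alpha> $$ (?s, s) * v $ s)"
    unfolding sum_distrib_left using rs
    by (intro sum.cong refl) (auto simp: mode_mat_def d_def field_simps)
  also have "\<dots> = kron_vec u (mode_mat b \<alpha> *\<^sub>v v) $ i"
    using i rs u v by (simp add: kron_vec_def mode_mat_def scalar_prod_def atLeast0LessThan)
  finally show "(normalized_adj (ring_adj b q) *\<^sub>v kron_vec u v) $ i =
      kron_vec u (mode_mat b \<alpha> *\<^sub>v v) $ i" .
qed

lemma kron_vec_smult_right: "kron_vec u (c \<cdot>\<^sub>v v) = c \<cdot>\<^sub>v kron_vec u v"
proof (rule eq_vecI)
  fix i assume "i < dim_vec (c \<cdot>\<^sub>v kron_vec u v)"
  then have "i < dim_vec u * dim_vec v" by simp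
  with div_mod_less[OF this] show "kron_vec u (c \<cdot>\<^sub>v v) $ i = (c \<cdot>\<^sub>v kron_vec u v) $ i"
    by (simp add: kron_vec_def)
qed simp

subsection \<open>Trigonometric eigenvectors of the cycle\<close>

text \<open>A geometric sum: the ratio \<open>z\<close> satisfies \<open>z ^ q = 1\<close>, so the
  sum vanishes unless \<open>z = 1\<close>, which happens exactly when \<open>q\<close> divides
  \<open>m\<close>.\<close>

lemma sum_cis_roots:
  fixes m :: int
  assumes "q > 0"
  shows "(\<Sum>j<q. cis (2 * pi * of_int m * real j / real q)) = (if int q dvd m then of_nat q else 0)"
proof -
  define z where "z = cis (2 * pi * of_int m / real q)"
  have pow: "cis (2 * pi * of_int m * real j / real q) = z ^ j" for j
    by (simp add: z_def DeMoivre mult_ac)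
  have "z ^ q = cis (2 * pi * of_int m)"
    using assms by (simp add: z_def DeMoivre)
  then have zq: "z ^ q = 1"
    by (simp add: cis_multiple_2pi)
  have z1: "z = 1 \<longleftrightarrow> int q dvd m"
  proof
    assume "z = 1"
    then have "cos (2 * pi * of_int m / real q) = 1"
      by (metis z_def cis.sel(1) one_complex.sel(1))
    then obtain n :: int where "2 * pi * of_int m / real q = of_int n * 2 * pi"
      by (auto simp: cos_one_2pi_int)
    then have "(of_int m :: real) = of_int n * real q"
      using assms by (simp add: field_simps)
    then have "(of_int m :: real) = of_int (n * int q)" by simp
    then have "m = n * int q" by linarith
    then show "int q dvd m" by simp
  next
    assume "int q dvd m"
    then obtain n where "m = int q * n" by (auto elim: dvdE)
    then have "2 * pi * of_int m / real q = 2 * pi * of_int n" using assms by simp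
    then show "z = 1" by (simp add: z_def cis_multiple_2pi)
  qed
  have "(\<Sum>j<q. z ^ j) = (if int q dvd m then of_nat q else 0)"
    using geometric_sum[of z q] zq z1 by auto
  then show ?thesis by (simp add: pow)
qed

lemma sum_cos_roots:
  fixes m :: int
  assumes "q > 0"
  shows "(\<Sum>j<q. cos (2 * pi * of_int m * real j / real q)) = (if int q dvd m then real q else 0)"
  using arg_cong[OF sum_cis_roots[OF assms, of m], of Re] by (simp split: if_splits)

lemma sum_sin_roots:
  fixes m :: int
  assumes "q > 0"
  shows "(\<Sum>j<q. sin (2 * pi * of_int m * real j / real q)) = 0"
  using arg_cong[OF sum_cis_roots[OF assms, of m], of Im] by (simp split: if_splits)

definition hartley_vec :: "nat \<Rightarrow> nat \<Rightarrow> real vec" where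
  "hartley_vec q k =
     vec q (\<lambda>j. cos (2 * pi * real k * real j / real q) + sin (2 * pi * real k * real j / real q))"

text \<open>The product of two entries is \<open>cos (x - y) + sin (x + y)\<close>. The sine part
  always sums to 0, and the cosine part survives only if \<open>q\<close> divides
  \<open>k - l\<close>, that is for \<open>k = l\<close> in the given range.\<close>

lemma scalar_prod_hartley:
  assumes "k < q" "l < q"
  shows "hartley_vec q k \<bullet> hartley_vec q l = (if k = l then real q else 0)"
proof -
  let ?h = "\<lambda>k. vec q (\<lambda>j. cos (2 * pi * real k * real j / real q)
    + sin (2 * pi * real k * real j / real q))"
  have q: "q > 0" using assms by simp
  have prod: "(cos x + sin x) * (cos y + sin y) = cos (x - y) + sin (x + y)" for x y :: real
    by (simp add: cos_diff sin_add algebra_simps)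
  have "hartley_vec q k \<bullet> hartley_vec q l =
      (\<Sum>j<q. cos (2 * pi * of_int (int k - int l) * real j / real q)
            + sin (2 * pi * of_int (int k + int l) * real j / real q))"
    unfolding hartley_vec_def scalar_prod_def dim_vec atLeast0LessThan
  proof (rule sum.cong[OF refl])
    fix j assume "j \<in> {..<q}"
    moreover have "2 * pi * of_int (int k - int l) * real j / real q =
        2 * pi * real k * real j / real q - 2 * pi * real l * real j / real q"
      "2 * pi * of_int (int k + int l) * real j / real q =
        2 * pi * real k * real j / real q + 2 * pi * real l * real j / real q"
      by (simp_all add: ring_distribs add_divide_distrib diff_divide_distrib)
    ultimately show "?h k $ j * ?h l $ j = cos (2 * pi * of_int (int k - int l) * real j / real q)
        + sin (2 * pi * of_int (int k + int l) * real j / real q)"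
      by (simp only: lessThan_iff index_vec prod)
  qed
  also have "\<dots> = (if int q dvd int k - int l then real q else 0)"
    using sum_cos_roots[OF q] sum_sin_roots[OF q] by (simp only: sum.distrib add_0_right)
  also have "int q dvd int k - int l \<longleftrightarrow> k = l"
  proof
    assume "int q dvd int k - int l"
    then have "int k mod int q = int l mod int q" by (simp add: mod_eq_dvd_iff)
    then show "k = l" using assms by simp
  qed simp
  finally show ?thesis .
qed

text \<open>The coefficients \<open>x\<close>, \<open>y\<close> and the offset \<open>c\<close>
  cover all three families at once: \<open>c = 0\<close> for the Hartley vectors,
  \<open>c = 1\<close> for the cosine and sine vectors, whose entries are numbered from 1.\<close>

lemma cycle_mat_trig:
  fixes c x y :: real
  assumes q: "q \<ge> 3"
  shows "cycle_mat q *\<^sub>v vec q (\<lambda>j. x * cos (2 * pi * real k * (real j + c) / real q)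
           + y * sin (2 * pi * real k * (real j + c) / real q)) =
         ring_alpha q k \<cdot>\<^sub>v vec q (\<lambda>j. x * cos (2 * pi * real k * (real j + c) / real q)
           + y * sin (2 * pi * real k * (real j + c) / real q))"
proof (rule cycle_mat_eigen[OF q])
  fix j
  have "2 * pi * real k * (real (j + q) + c) / real q =
      2 * pi * real k * (real j + c) / real q + 2 * pi * real_of_int (int k)"
    using q by (simp add: field_simps)
  then show "x * cos (2 * pi * real k * (real (j + q) + c) / real q)
        + y * sin (2 * pi * real k * (real (j + q) + c) / real q) =
      x * cos (2 * pi * real k * (real j + c) / real q)
        + y * sin (2 * pi * real k * (real j + c) / real q)"
    by (simp only: sin_add cos_add cos_int_2pin sin_int_2pin mult_1_right mult_zero_right
      diff_0_right add_0_right)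
next
  fix j
  let ?\<theta> = "2 * pi * real k / real q" and ?t = "2 * pi * real k * (real (j + 1) + c) / real q"
  \<comment> \<open>Centring at the middle index \<open>j + 1\<close> makes the recurrence the sum
    of the addition formulas for angles \<open>?t + ?\<theta>\<close> and
    \<open>?t - ?\<theta>\<close>.\<close>
  have eq: "2 * pi * real k * (real (j + 2) + c) / real q = ?t + ?\<theta>"
    "2 * pi * real k * (real j + c) / real q = ?t - ?\<theta>"
    by (simp_all add: add_divide_distrib[symmetric] diff_divide_distrib[symmetric] algebra_simps)
  show "x * cos (2 * pi * real k * (real (j + 2) + c) / real q)
        + y * sin (2 * pi * real k * (real (j + 2) + c) / real q)
      + (x * cos (2 * pi * real k * (real j + c) / real q)
        + y * sin (2 * pi * real k * (real j + c) / real q)) =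
      ring_alpha q k * (x * cos ?t + y * sin ?t)"
    unfolding eq cos_add cos_diff sin_add sin_diff ring_alpha_def by (simp add: algebra_simps)
qed

lemma cycle_mat_hartley:
  assumes "q \<ge> 3"
  shows "cycle_mat q *\<^sub>v hartley_vec q k = ring_alpha q k \<cdot>\<^sub>v hartley_vec q k"
  using cycle_mat_trig[OF assms, of 1 k 0 1] by (simp add: hartley_vec_def)

lemma cycle_mat_cos_vec:
  assumes "q \<ge> 3"
  shows "cycle_mat q *\<^sub>v cos_vec k q = ring_alpha q k \<cdot>\<^sub>v cos_vec k q"
  using cycle_mat_trig[OF assms, of 1 k 1 0] by (simp add: cos_vec_def add.commute)

lemma cycle_mat_sin_vec:
  assumes "q \<ge> 3"
  shows "cycle_mat q *\<^sub>v sin_vec k q = ring_alpha q k \<cdot>\<^sub>v sin_vec k q"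
  using cycle_mat_trig[OF assms, of 0 k 1 1] by (simp add: sin_vec_def add.commute)

subsection \<open>Eigenvectors of a single mode\<close>

definition clique_vec :: "nat \<Rightarrow> real \<Rightarrow> real vec" where
  "clique_vec b x = vec b (\<lambda>s. if s = 0 then x else 1)"

lemma clique_vec_eq: "x \<cdot>\<^sub>v e1 b + g1 b = clique_vec b x"
  by (rule eq_vecI) (auto simp: clique_vec_def e1_def g1_def ones_vec_def)

lemma sum_lessThan_corner:
  fixes x y :: "'a::comm_ring_1"
  assumes "b \<ge> 1"
  shows "(\<Sum>s<b. if s = 0 then x else y) = x + (of_nat b - 1) * y"
proof -
  have "(\<Sum>s<b. if s = 0 then x else y) = x + (\<Sum>s\<in>{..<b} - {0}. y)"
    using assms by (subst sum.remove[of _ 0]) (auto intro!: arg_cong2[of _ _ _ _ "(+)"] sum.cong)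
  then show ?thesis using assms by (simp add: of_nat_diff)
qed

text \<open>Up to the outer scaling the matrix is a rank-one part plus a diagonal part, so its
  action on \<open>v\<close> requires only one weighted sum of the entries of
  \<open>v\<close>.\<close>

lemma mode_mat_index:
  fixes b :: nat and v :: "real vec"
  defines "d \<equiv> \<lambda>s::nat. sqrt (if s = 0 then real b + 1 else real b - 1)"
  assumes "dim_vec v = b" "s < b"
  shows "(mode_mat b \<alpha> *\<^sub>v v) $ s =
    ((\<Sum>t<b. v $ t / d t) - v $ s / d s + (if s = 0 then \<alpha> * v $ 0 / d 0 else 0)) / d s"
proof -
  have "(mode_mat b \<alpha> *\<^sub>v v) $ s = (\<Sum>t<b. (v $ t / d t - (if s = t then v $ t / d t else 0)
      + (if t = 0 then (if s = 0 then \<alpha> * v $ t / d t else 0) else 0)) / d s)"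
    using assms
    by (auto simp: mode_mat_def scalar_prod_def atLeast0LessThan field_simps intro!: sum.cong)
  also have "\<dots> = ((\<Sum>t<b. v $ t / d t) - v $ s / d s + (if s = 0 then \<alpha> * v $ 0 / d 0 else 0)) / d s"
    using assms(3)
    by (simp add: sum_divide_distrib[symmetric] sum.distrib sum_subtractf)
  finally show ?thesis .
qed

lemma sqrt_pred_succ:
  "sqrt ((real b)\<^sup>2 - 1) = sqrt (real b + 1) * sqrt (real b - 1)"
  by (simp add: real_sqrt_mult[symmetric] power2_eq_square algebra_simps)

text \<open>Multiplying by the square root clears all radicals in the definition of
  \<open>ring_beta\<close>, leaving a polynomial in \<open>b\<close>.\<close>

lemma ring_beta_eq:
  assumes "b \<ge> 2"
  shows "2 * ring_beta b q k * sqrt ((real b)\<^sup>2 - 1) =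
    ring_alpha q k * (real b - 1) - ((real b)\<^sup>2 - 1) + (real b + 1)"
proof -
  define p r where "p = sqrt (real b + 1)" and "r = sqrt (real b - 1)"
  have pr: "p > 0" "r > 0" "p * p = real b + 1" "r * r = real b - 1"
    using assms by (auto simp: p_def r_def)
  have "2 * ring_beta b q k = ring_alpha q k * (r / p) - p * r + p / r"
    unfolding ring_beta_def sqrt_pred_succ real_sqrt_divide p_def r_def
    by (simp add: field_simps)
  then have "2 * ring_beta b q k * (p * r) = (ring_alpha q k * (r / p) - p * r + p / r) * (p * r)"
    by simp
  also have "\<dots> = ring_alpha q k * (r * r) - (p * p) * (r * r) + p * p"
    using pr(1,2) by (simp add: field_simps)
  also have "\<dots> = ring_alpha q k * (real b - 1) - ((real b)\<^sup>2 - 1) + (real b + 1)"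
    unfolding pr by (simp add: power2_eq_square algebra_simps)
  finally show ?thesis by (simp add: sqrt_pred_succ p_def r_def)
qed

lemma ring_xi_quadratic:
  assumes "b \<ge> 2"
  shows "(ring_xi b q i k)\<^sup>2 = 2 * ring_beta b q k * ring_xi b q i k + (real b - 1)"
proof -
  have "(sqrt ((ring_beta b q k)\<^sup>2 + (real b - 1)))\<^sup>2 = (ring_beta b q k)\<^sup>2 + (real b - 1)"
    using assms by simp
  then show ?thesis
    unfolding ring_xi_def by (simp add: power2_eq_square algebra_simps)
qed

lemma ring_xi_prod:
  assumes "b \<ge> 2"
  shows "ring_xi b q 1 k * ring_xi b q 2 k = - (real b - 1)"
proof -
  have "(sqrt ((ring_beta b q k)\<^sup>2 + (real b - 1)))\<^sup>2 = (ring_beta b q k)\<^sup>2 + (real b - 1)"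
    using assms by simp
  then show ?thesis
    unfolding ring_xi_def by (simp add: power2_eq_square algebra_simps)
qed

text \<open>For a vector with corner entry \<xi> and all other entries 1, the non-corner rows force
  the eigenvalue to be \<open>ring_lambda\<close>. The corner row is then equivalent to the
  quadratic equation for \<xi>.\<close>

lemma mode_mat_clique_vec:
  assumes b: "b \<ge> 2"
  shows "mode_mat b (ring_alpha q k) *\<^sub>v clique_vec b (ring_xi b q i k) =
    ring_lambda b q i k \<cdot>\<^sub>v clique_vec b (ring_xi b q i k)"
proof (rule eq_vecI)
  define p r where "p = sqrt (real b + 1)" and "r = sqrt (real b - 1)"
  define \<xi> \<alpha> where "\<xi> = ring_xi b q i k" and "\<alpha> = ring_alpha q k"
  have pr: "p > 0" "r > 0" "p * p = r * r + 2" "real b - 1 = r * r" "real b + 1 = p * p"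
    using b by (auto simp: p_def r_def)
  have "\<xi>\<^sup>2 * (p * r) = (2 * ring_beta b q k * sqrt ((real b)\<^sup>2 - 1)) * \<xi> + r * r * (p * r)"
    unfolding \<xi>_def ring_xi_quadratic[OF b] sqrt_pred_succ p_def[symmetric] r_def[symmetric]
      pr(4) using pr(2) by (simp add: algebra_simps)
  also have "2 * ring_beta b q k * sqrt ((real b)\<^sup>2 - 1) =
      \<alpha> * (r * r) - (p * p) * (r * r) + p * p"
    unfolding ring_beta_eq[OF b] pr(4,5)[symmetric] \<alpha>_def by (simp add: power2_eq_square algebra_simps)
  finally have quad: "\<xi>\<^sup>2 * (p * r) = (\<alpha> * (r * r) - (p * p) * (r * r) + p * p) * \<xi> + r * r * (p * r)" .
  have lam: "ring_lambda b q i k = \<xi> / (p * r) + 1 - 1 / (r * r)"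
    unfolding ring_lambda_def sqrt_pred_succ pr(4) using b by (simp add: \<xi>_def p_def r_def)
  have sum: "(\<Sum>t<b. clique_vec b \<xi> $ t / sqrt (if t = 0 then real b + 1 else real b - 1)) =
      \<xi> / p + r"
  proof -
    have "(\<Sum>t<b. clique_vec b \<xi> $ t / sqrt (if t = 0 then real b + 1 else real b - 1)) =
        (\<Sum>t<b. if t = 0 then \<xi> / p else 1 / r)"
      by (intro sum.cong) (auto simp: clique_vec_def p_def r_def)
    also have "\<dots> = \<xi> / p + r"
      using b pr by (simp add: sum_lessThan_corner)
    finally show ?thesis .
  qed
  fix s assume "s < dim_vec (ring_lambda b q i k \<cdot>\<^sub>v clique_vec b (ring_xi b q i k))"
  then have s: "s < b" by (simp add: clique_vec_def)
  have corner: "clique_vec b \<xi> $ s = (if s = 0 then \<xi> else 1)" "dim_vec (clique_vec b \<xi>) = b"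
    using s by (simp_all add: clique_vec_def)
  show "(mode_mat b (ring_alpha q k) *\<^sub>v clique_vec b (ring_xi b q i k)) $ s =
      (ring_lambda b q i k \<cdot>\<^sub>v clique_vec b (ring_xi b q i k)) $ s"
  proof (cases "s = 0")
    case True
    have "(mode_mat b \<alpha> *\<^sub>v clique_vec b \<xi>) $ 0 = (r + \<alpha> * \<xi> / p) / p"
      using s True corner by (subst mode_mat_index) (simp_all add: sum p_def)
    also have "\<dots> = ring_lambda b q i k * \<xi>"
    proof -
      \<comment> \<open>Over the common denominator, the defect of the corner row is the difference
        of the two sides of \<open>quad\<close>.\<close>
      have "(r + \<alpha> * \<xi> / p) / p - ring_lambda b q i k * \<xi> =
          ((\<alpha> * (r * r) - (p * p) * (r * r) + p * p) * \<xi> + r * r * (p * r) - \<xi>\<^sup>2 * (p * r))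
          / ((p * r) * (p * r))"
        using pr(1,2) unfolding lam by (simp add: field_simps power2_eq_square)
      then show ?thesis unfolding quad by simp
    qed
    finally show ?thesis using s True by (simp add: clique_vec_def \<alpha>_def \<xi>_def)
  next
    case False
    have "(mode_mat b \<alpha> *\<^sub>v clique_vec b \<xi>) $ s = (\<xi> / p + r - 1 / r) / r"
      using s False corner by (subst mode_mat_index) (simp_all add: sum r_def)
    also have "\<dots> = ring_lambda b q i k"
      using pr(1,2) unfolding lam by (simp add: field_simps)
    finally show ?thesis using s False by (simp add: clique_vec_def \<alpha>_def \<xi>_def)
  qed
qed (simp add: mode_mat_def clique_vec_def)

text \<open>The all-ones part and the corner term both vanish on \<open>v\<close>; what remains is
  \<open>- I\<close> scaled by the non-corner degree.\<close>

lemma mode_mat_balanced: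
  assumes "dim_vec v = b" "b > 0" "v $ 0 = 0" "(\<Sum>t<b. v $ t) = 0"
  shows "mode_mat b \<alpha> *\<^sub>v v = (- 1 / (real b - 1)) \<cdot>\<^sub>v v"
proof (rule eq_vecI)
  have "(\<Sum>t<b. v $ t / sqrt (if t = 0 then real b + 1 else real b - 1)) =
      (\<Sum>t<b. v $ t / sqrt (real b - 1))"
    using assms(3) by (intro sum.cong) auto
  then have sum: "(\<Sum>t<b. v $ t / sqrt (if t = 0 then real b + 1 else real b - 1)) = 0"
    using assms(4) by (simp add: sum_divide_distrib[symmetric])
  fix s assume "s < dim_vec ((- 1 / (real b - 1)) \<cdot>\<^sub>v v)"
  then show "(mode_mat b \<alpha> *\<^sub>v v) $ s = ((- 1 / (real b - 1)) \<cdot>\<^sub>v v) $ s"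
    using assms by (subst mode_mat_index) (auto simp: sum)
qed (use assms in \<open>simp add: mode_mat_def\<close>)

subsection \<open>The characteristic polynomial\<close>

lemma order_prod_list_linear:
  fixes \<mu> :: "'a::idom"
  shows "Polynomial.order \<mu> (\<Prod>a\<leftarrow>as. [:- a, 1:]) = (\<Sum>a\<leftarrow>as. if a = \<mu> then 1 else 0)"
proof (induction as)
  case (Cons a as)
  have "(\<Prod>a\<leftarrow>as. [:- a, 1:]) \<noteq> 0"
    by (induction as) (auto simp del: mult_pCons_left)
  then have "Polynomial.order \<mu> (\<Prod>a\<leftarrow>a # as. [:- a, 1:]) =
      Polynomial.order \<mu> [:- a, 1:] + (\<Sum>a\<leftarrow>as. if a = \<mu> then 1 else 0)"
    using Cons.IH by (simp add: order_mult del: mult_pCons_left)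
  moreover have "Polynomial.order \<mu> [:- a, 1:] = (if a = \<mu> then 1 else 0)"
    using order_power_n_n[of a 1] by (auto intro!: order_0I)
  ultimately show ?case by simp
qed simp

text \<open>\<open>A\<close> is similar to the diagonal matrix of \<open>f\<close>. Indices with
  equal values of \<open>f\<close> are all counted, which is exactly the convention that coinciding
  eigenvalues add up.\<close>

lemma order_char_poly_diagonalizable:
  fixes A :: "'a::field mat"
  assumes A: "A \<in> carrier_mat n n" and P: "P \<in> carrier_mat n n" and Q: "Q \<in> carrier_mat n n"
    and QP: "Q * P = 1\<^sub>m n" and AP: "A * P = P * mat_diag n f"
  shows "Polynomial.order \<mu> (char_poly A) = (\<Sum>i<n. if f i = \<mu> then 1 else 0)"
proof -
  let ?D = "mat_diag n f"
  have PQ: "P * Q = 1\<^sub>m n"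
    by (rule mat_mult_left_right_inverse[OF Q P QP])
  have "A = A * (P * Q)" using A by (simp add: PQ)
  also have "\<dots> = P * ?D * Q"
    using assoc_mult_mat[OF A P Q] by (simp add: AP)
  finally have "similar_mat A ?D"
    using A P Q PQ QP by (intro similar_matI[of _ _ P Q n]) auto
  then have "char_poly A = char_poly ?D" by (rule char_poly_similar)
  also have "\<dots> = (\<Prod>a\<leftarrow>diag_mat ?D. [:- a, 1:])"
    by (rule char_poly_upper_triangular[of _ n]) (auto simp: mat_diag_def)
  also have "diag_mat ?D = map f [0..<n]"
    by (simp add: diag_mat_def mat_diag_def)
  finally have "Polynomial.order \<mu> (char_poly A) = (\<Sum>a\<leftarrow>map f [0..<n]. if a = \<mu> then 1 else 0)"
    by (simp only: order_prod_list_linear)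
  then show ?thesis
    by (simp only: map_map interv_sum_list_conv_sum_set_nat set_upt atLeast0LessThan o_def)
qed

text \<open>\<open>clique_dual\<close> is the dual basis of \<open>clique_basis\<close>. The first two basis vectors are orthogonal to
  each other because \<open>\<xi>\<^sub>1 \<xi>\<^sub>2 = - (b - 1)\<close>.\<close>

definition clique_basis :: "nat \<Rightarrow> nat \<Rightarrow> nat \<Rightarrow> nat \<Rightarrow> real vec" where
  "clique_basis b q k s =
     (if s < 2 then clique_vec b (ring_xi b q (s + 1) k)
      else vec b (\<lambda>t. (if t = 1 then 1 else 0) - (if t = s then 1 else 0)))"

definition clique_dual :: "nat \<Rightarrow> nat \<Rightarrow> nat \<Rightarrow> nat \<Rightarrow> real vec" where
  "clique_dual b q k s =
     (if s < 2 then (1 / ((ring_xi b q (s + 1) k)\<^sup>2 + (real b - 1))) \<cdot>\<^sub>v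
        clique_vec b (ring_xi b q (s + 1) k)
      else vec b (\<lambda>t. (if t = 0 then 0 else 1 / (real b - 1)) - (if t = s then 1 else 0)))"

definition clique_eval :: "nat \<Rightarrow> nat \<Rightarrow> nat \<Rightarrow> nat \<Rightarrow> real" where
  "clique_eval b q k s = (if s < 2 then ring_lambda b q (s + 1) k else - 1 / (real b - 1))"

lemma dim_clique [simp]:
  "dim_vec (clique_vec b x) = b" "dim_vec (clique_basis b q k s) = b"
  "dim_vec (clique_dual b q k s) = b" "dim_vec (hartley_vec q k) = q"
  by (simp_all add: clique_vec_def clique_basis_def clique_dual_def hartley_vec_def)

lemma scalar_prod_clique_vec:
  assumes "b \<ge> 2"
  shows "clique_vec b x \<bullet> clique_vec b y = x * y + (real b - 1)"
proof -
  have "clique_vec b x \<bullet> clique_vec b y = (\<Sum>s<b. if s = 0 then x * y else 1)"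
    by (auto simp: scalar_prod_def clique_vec_def atLeast0LessThan intro!: sum.cong)
  then show ?thesis using assms by (simp add: sum_lessThan_corner)
qed

text \<open>For \<open>s \<ge> 2\<close> the dual vector maps \<open>w\<close> to the mean of its
  non-corner entries minus its entry at \<open>s\<close>: this kills vectors that are constant off
  the corner and separates the differences. Conversely, \<open>clique_vec\<close> is constant off
  the corner and so annihilates these differences.\<close>

lemma clique_dual_basis:
  assumes b: "b \<ge> 2" and st: "s < b" "t < b"
  shows "clique_dual b q k s \<bullet> clique_basis b q k t = (if s = t then 1 else 0)"
proof -
  have pos: "x\<^sup>2 + (real b - 1) > 0" for x
    using b by (intro add_nonneg_pos) auto
  consider "s < 2" "t < 2" | "s < 2" "t \<ge> 2" | "s \<ge> 2" "t < 2" | "s \<ge> 2" "t \<ge> 2" by linarith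
  then show ?thesis
  proof cases
    case 1
    then have "s = t \<or> s = 0 \<and> t = 1 \<or> s = 1 \<and> t = 0" by auto
    then show ?thesis
      using 1 pos[of "ring_xi b q (s + 1) k"] ring_xi_prod[OF b, of q k]
      by (auto simp: clique_dual_def clique_basis_def scalar_prod_clique_vec[OF b] power2_eq_square
        numeral_2_eq_2 mult.commute)
  next
    case 2
    have "clique_vec b x \<bullet> clique_basis b q k t =
        (\<Sum>r<b. (if r = 1 then 1 else 0) - (if r = t then 1 else 0))" for x
      using 2 by (auto simp: clique_basis_def clique_vec_def scalar_prod_def atLeast0LessThan intro!: sum.cong)
    then show ?thesis
      using 2 st by (simp add: clique_dual_def sum_subtractf)
  next
    case 3
    have "clique_dual b q k s \<bullet> clique_vec b x =
        (\<Sum>r<b. (if r = 0 then 0 else 1 / (real b - 1)) - (if r = s then 1 else 0))" for x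
      using 3 by (auto simp: clique_dual_def clique_vec_def scalar_prod_def atLeast0LessThan intro!: sum.cong)
    then show ?thesis
      using 3 b st by (simp add: clique_basis_def sum_subtractf sum_lessThan_corner)
  next
    case 4
    have "clique_dual b q k s \<bullet> clique_basis b q k t =
        (\<Sum>r<b. clique_dual b q k s $ r * clique_basis b q k t $ r)"
      by (simp add: scalar_prod_def atLeast0LessThan)
    also have "\<dots> =
        (\<Sum>r<b. (if r = 1 then 1 / (real b - 1) else 0) - (if r = t then 1 / (real b - 1) else 0)
          + (if r = t then (if s = t then 1 else 0) else 0))"
      by (intro sum.cong refl) (use 4 in \<open>auto simp: clique_dual_def clique_basis_def\<close>)
    finally show ?thesis
      using 4 st b by (simp add: sum.distrib sum_subtractf)
  qed
qed

lemma mode_mat_clique_basis: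
  assumes b: "b \<ge> 2" and "s < b"
  shows "mode_mat b (ring_alpha q k) *\<^sub>v clique_basis b q k s =
    clique_eval b q k s \<cdot>\<^sub>v clique_basis b q k s"
proof (cases "s < 2")
  case True
  then show ?thesis by (simp add: clique_basis_def clique_eval_def mode_mat_clique_vec[OF b])
next
  case False
  have "(\<Sum>t<b. clique_basis b q k s $ t) = 0"
    using False assms by (simp add: clique_basis_def sum_subtractf)
  then show ?thesis
    using False assms mode_mat_balanced[of "clique_basis b q k s" b]
    by (simp add: clique_eval_def) (simp add: clique_basis_def)
qed

text \<open>The clique basis may vary with the frequency \<open>k\<close>, because Hartley vectors
  of different frequencies are already orthogonal; duality of the clique factors matters only for
  equal \<open>k\<close>.\<close>

lemma mult_of_ring_clique_eval:
  assumes b: "b \<ge> 2" and q: "q \<ge> 3"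
  shows "mult_of (normalized_adj (ring_adj b q)) \<mu> =
    (\<Sum>k<q. \<Sum>s<b. if clique_eval b q k s = \<mu> then 1 else 0)"
proof -
  let ?n = "q * b" and ?A = "normalized_adj (ring_adj b q)"
  define p where "p i = kron_vec (hartley_vec q (i div b)) (clique_basis b q (i div b) (i mod b))" for i
  define d where "d i = kron_vec (hartley_vec q (i div b)) (clique_dual b q (i div b) (i mod b))" for i
  define f where "f i = clique_eval b q (i div b) (i mod b)" for i
  define P where "P = mat ?n ?n (\<lambda>(i, j). p j $ i)"
  \<comment> \<open>The factor \<open>1 / real q\<close> compensates for the squared length
    \<open>q\<close> of the Hartley vectors.\<close>
  define Q where "Q = mat ?n ?n (\<lambda>(i, j). d i $ j / real q)"
  have dims [simp]: "dim_vec (p i) = ?n" "dim_vec (d i) = ?n" for i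
    by (simp_all add: p_def d_def)
  have P: "P \<in> carrier_mat ?n ?n" and Q: "Q \<in> carrier_mat ?n ?n"
    by (simp_all add: P_def Q_def)
  have "Q * P = 1\<^sub>m ?n"
  proof (rule eq_matI)
    fix i j assume "i < dim_row (1\<^sub>m ?n :: real mat)" "j < dim_col (1\<^sub>m ?n :: real mat)"
    then have ij: "i < ?n" "j < ?n" by simp_all
    note i = div_mod_less[OF ij(1)] and j = div_mod_less[OF ij(2)]
    have "(Q * P) $$ (i, j) = (d i \<bullet> p j) / real q"
      using ij by (simp add: P_def Q_def scalar_prod_def sum_divide_distrib)
    also have "\<dots> = (if i div b = j div b then 1 else 0)
        * (clique_dual b q (i div b) (i mod b) \<bullet> clique_basis b q (j div b) (j mod b))"
      using q i j by (simp add: d_def p_def scalar_prod_kron_vec scalar_prod_hartley)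
    also have "\<dots> = (if i div b = j div b \<and> i mod b = j mod b then 1 else 0)"
      using i j by (simp add: clique_dual_basis[OF b])
    also have "\<dots> = (if i = j then 1 else 0)"
      by (metis div_mult_mod_eq)
    finally show "(Q * P) $$ (i, j) = (1\<^sub>m ?n :: real mat) $$ (i, j)"
      using ij by simp
  qed (simp_all add: P_def Q_def)
  moreover have "?A * P = P * mat_diag ?n f"
  proof (rule eq_matI)
    fix i j assume "i < dim_row (P * mat_diag ?n f)" "j < dim_col (P * mat_diag ?n f)"
    then have ij: "i < ?n" "j < ?n" by (simp_all add: P_def mat_diag_def)
    \<comment> \<open>The matrix identity is checked by columns: column \<open>j\<close> is the
      eigenvector equation for \<open>p j\<close>.\<close>
    have "col P j = p j" using ij by (auto simp: P_def)
    then have "(?A * P) $$ (i, j) = (?A *\<^sub>v p j) $ i"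
      using ij P carrier_matD[OF normalized_ring_carrier[of b q]] by simp
    also have "?A *\<^sub>v p j = f j \<cdot>\<^sub>v p j"
      using normalized_ring_mult_kron_vec[OF b q _ _ cycle_mat_hartley[OF q]]
        mode_mat_clique_basis[OF b div_mod_less(2)[OF ij(2)]]
      by (simp add: p_def f_def kron_vec_smult_right)
    also have "(f j \<cdot>\<^sub>v p j) $ i = (P * mat_diag ?n f) $$ (i, j)"
      unfolding mat_diag_mult_right[OF P] using ij by (simp add: P_def)
    finally show "(?A * P) $$ (i, j) = (P * mat_diag ?n f) $$ (i, j)" .
  qed (use P carrier_matD[OF normalized_ring_carrier[of b q]] in \<open>simp_all add: mat_diag_def\<close>)
  ultimately have "mult_of ?A \<mu> = (\<Sum>i<?n. if f i = \<mu> then 1 else 0)"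
    unfolding mult_of_def by (intro order_char_poly_diagonalizable[OF normalized_ring_carrier P Q])
  also have "\<dots> = (\<Sum>k<q. \<Sum>s<b. if clique_eval b q k s = \<mu> then 1 else 0)"
    unfolding f_def by (rule sum_div_mod)
  finally show ?thesis .
qed

section \<open>Folding the frequencies \<open>k\<close> and \<open>q - k\<close>\<close>

lemma ring_alpha_reflect:
  assumes "k \<le> q" "q > 0"
  shows "ring_alpha q (q - k) = ring_alpha q k"
proof -
  have "2 * pi * real (q - k) / real q = 2 * pi - 2 * pi * real k / real q"
    using assms by (simp add: of_nat_diff field_simps)
  then show ?thesis by (simp add: ring_alpha_def cos_diff)
qed

lemma nat_ceiling_half: "nat \<lceil>real q / 2\<rceil> = (q + 1) div 2"
proof (cases "even q")
  case True
  then obtain p where "q = 2 * p" by (auto elim: evenE)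
  then show ?thesis by simp
next
  case False
  then obtain p where q: "q = 2 * p + 1" by (auto elim: oddE)
  have "\<lceil>real q / 2\<rceil> = int p + 1" unfolding q by (rule ceiling_unique) auto
  then show ?thesis by (simp add: q)
qed

text \<open>The range below \<open>q\<close> splits into \<open>{0..p}\<close>, the midpoint
  \<open>q div 2\<close> for even \<open>q\<close>, and \<open>{q - p..<q}\<close>. The last part
  mirrors \<open>{1..p}\<close>, which accounts for the weight 2 there; 0 and the midpoint have no
  separate mirror image.\<close>

lemma sum_modes:
  fixes g m :: "nat \<Rightarrow> nat"
  assumes q: "q \<ge> 3" and sym: "\<And>k. 0 < k \<Longrightarrow> k < q \<Longrightarrow> g (q - k) = g k"
    and m0: "m 0 = 1" and m2: "\<And>k. k \<in> {1..nat \<lceil>real q / 2\<rceil> - 1} \<Longrightarrow> m k = 2"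
    and mh: "even q \<Longrightarrow> m (q div 2) = 1"
  shows "(\<Sum>k\<in>modes q. m k * g k) = (\<Sum>k<q. g k)"
proof -
  define p where "p = (q - 1) div 2"
  have p: "nat \<lceil>real q / 2\<rceil> - 1 = p"
    unfolding nat_ceiling_half p_def using q by (cases q) auto
  define H where "H = (if even q then {q div 2} else {})"
  have H: "H \<inter> {0..p} = {}" "H \<inter> {q - p..<q} = {}" "2 * p < q"
    unfolding H_def p_def using q by (auto elim!: evenE)
  have low: "{0..p} = insert 0 {1..p}" by auto
  have refl: "(\<Sum>k\<in>{q - p..<q}. g k) = (\<Sum>k\<in>{1..p}. g k)"
    using H(3) sym
    by (intro sum.reindex_bij_witness[where i = "\<lambda>k. q - k" and j = "\<lambda>k. q - k"]) auto
  have all: "{..<q} = {0..p} \<union> H \<union> {q - p..<q}"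
    unfolding H_def p_def using q by (auto elim!: evenE oddE)
  have mH: "(\<Sum>k\<in>H. m k * g k) = (\<Sum>k\<in>H. g k)"
    using mh by (simp add: H_def)
  have "modes q = {0..p} \<union> H"
    unfolding modes_def p H_def by simp
  then have "(\<Sum>k\<in>modes q. m k * g k) = (\<Sum>k\<in>{0..p}. m k * g k) + (\<Sum>k\<in>H. m k * g k)"
    using H by (simp add: sum.union_disjoint H_def Int_commute)
  also have "(\<Sum>k\<in>{0..p}. m k * g k) = g 0 + (\<Sum>k\<in>{1..p}. 2 * g k)"
    using m0 m2 unfolding low p by simp
  also have "(\<Sum>k\<in>{1..p}. 2 * g k) = (\<Sum>k\<in>{1..p}. g k) + (\<Sum>k\<in>{q - p..<q}. g k)"
    unfolding refl by (simp add: sum_distrib_left[symmetric])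
  also have "g 0 + ((\<Sum>k\<in>{1..p}. g k) + (\<Sum>k\<in>{q - p..<q}. g k)) + (\<Sum>k\<in>H. m k * g k) =
      (\<Sum>k\<in>{0..p}. g k) + (\<Sum>k\<in>H. g k) + (\<Sum>k\<in>{q - p..<q}. g k)"
    unfolding low mH by simp
  also have "\<dots> = (\<Sum>k<q. g k)"
  proof -
    have "({0..p} \<union> H) \<inter> {q - p..<q} = {}" using H by auto
    moreover have "finite H" by (simp add: H_def)
    ultimately show ?thesis
      unfolding all using H by (simp add: sum.union_disjoint Int_commute)
  qed
  finally show ?thesis .
qed

text \<open>At every frequency the two \<xi>-vectors contribute \<open>g k\<close> and the remaining
  \<open>b - 2\<close> basis vectors a constant. Since \<open>g\<close> depends on \<open>k\<close>
  only through \<open>ring_alpha\<close>, it is symmetric and \<open>sum_modes\<close>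
  applies.\<close>

lemma mult_of_ring:
  assumes b: "b \<ge> 2" and q: "q \<ge> 3"
    and m: "m 0 = 1" "\<And>k. k \<in> {1..nat \<lceil>real q / 2\<rceil> - 1} \<Longrightarrow> m k = 2"
      "even q \<Longrightarrow> m (q div 2) = 1"
  shows "mult_of (normalized_adj (ring_adj b q)) \<mu> = added_mult b q m \<mu>"
proof -
  define g where "g k = (\<Sum>i\<in>{1::nat, 2}. if ring_lambda b q i k = \<mu> then 1 else 0 :: nat)" for k
  define h where "h = (if \<mu> = - 1 / (real b - 1) then 1 else 0 :: nat)"
  have split: "{..<b} = {0, 1} \<union> {2..<b}" using b by auto
  have inner: "(\<Sum>s<b. if clique_eval b q k s = \<mu> then 1 else 0) = g k + (b - 2) * h" for k
  proof -
    have "(\<Sum>s<b. if clique_eval b q k s = \<mu> then 1 else 0) =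
        (\<Sum>s\<in>{0, 1}. if clique_eval b q k s = \<mu> then 1 else 0)
        + (\<Sum>s\<in>{2..<b}. if clique_eval b q k s = \<mu> then 1 else 0)"
      unfolding split by (rule sum.union_disjoint) auto
    also have "(\<Sum>s\<in>{0, 1}. if clique_eval b q k s = \<mu> then 1 else 0) = g k"
      by (simp add: clique_eval_def g_def numeral_2_eq_2)
    also have "(\<Sum>s\<in>{2..<b}. if clique_eval b q k s = \<mu> then 1 else 0) = (\<Sum>s\<in>{2..<b}. h)"
      by (intro sum.cong) (auto simp: clique_eval_def h_def)
    finally show ?thesis by simp
  qed
  have "g (q - k) = g k" if "0 < k" "k < q" for k
    using ring_alpha_reflect[of k q] that
    by (simp add: g_def ring_lambda_def ring_xi_def ring_beta_def)
  then have "(\<Sum>k\<in>modes q. m k * g k) = (\<Sum>k<q. g k)"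
    using q m by (intro sum_modes) auto
  moreover have "(\<Sum>k\<in>modes q. \<Sum>i\<in>{1, 2}. if ring_lambda b q i k = \<mu> then m k else 0) =
      (\<Sum>k\<in>modes q. m k * g k)"
    by (intro sum.cong) (auto simp: g_def)
  ultimately show ?thesis
    unfolding mult_of_ring_clique_eval[OF b q] inner added_mult_def by (simp add: sum.distrib h_def)
qed

subsection \<open>The stated eigenvectors\<close>

text \<open>To see that the vector is nonzero, look at \<open>r * b + 1\<close>, a non-corner vertex
  of clique \<open>r\<close>: the clique factor is 1 there whatever \<xi> is. The scalar
  \<open>c\<close> is for the rescaled vectors at \<open>k = 0\<close>.\<close>

lemma eigenvector_ring_evec:
  assumes b: "b \<ge> 2" and q: "q \<ge> 3" and u: "dim_vec u = q" "r < q" "u $ r \<noteq> 0"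
    and cyc: "cycle_mat q *\<^sub>v u = ring_alpha q k \<cdot>\<^sub>v u" and c: "c \<noteq> 0"
  shows "eigenvector (normalized_adj (ring_adj b q)) (c \<cdot>\<^sub>v ring_evec b q i k u) (ring_lambda b q i k)"
proof -
  let ?A = "normalized_adj (ring_adj b q)" and ?v = "ring_evec b q i k u"
  have v: "?v = kron_vec u (clique_vec b (ring_xi b q i k))"
    by (simp add: ring_evec_def clique_vec_eq)
  have v_carrier: "?v \<in> carrier_vec (q * b)"
    using u by (intro carrier_vecI) (simp add: v)
  have idx: "r * b + 1 < q * b" using mult_add_less[OF u(2), of 1 b] b by simp
  have "?v $ (r * b + 1) = u $ r"
    using idx u b div_mod_mult_add[of 1 b r]
    by (simp add: v kron_vec_def clique_vec_def del: div_mod_mult_add)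
  then have "(c \<cdot>\<^sub>v ?v) $ (r * b + 1) \<noteq> 0"
    using idx v_carrier u c by simp
  then have "c \<cdot>\<^sub>v ?v \<noteq> 0\<^sub>v (q * b)" using idx by auto
  moreover have "?A *\<^sub>v (c \<cdot>\<^sub>v ?v) = ring_lambda b q i k \<cdot>\<^sub>v (c \<cdot>\<^sub>v ?v)"
  proof -
    have "?A *\<^sub>v ?v = ring_lambda b q i k \<cdot>\<^sub>v ?v"
      unfolding v using normalized_ring_mult_kron_vec[OF b q u(1) _ cyc]
      by (simp add: mode_mat_clique_vec[OF b] kron_vec_smult_right)
    moreover have "?A *\<^sub>v (c \<cdot>\<^sub>v ?v) = c \<cdot>\<^sub>v (?A *\<^sub>v ?v)"
      by (rule mult_mat_vec[OF normalized_ring_carrier v_carrier])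
    ultimately show ?thesis by (simp add: smult_smult_assoc mult.commute)
  qed
  ultimately show ?thesis
    unfolding eigenvector_def carrier_matD[OF normalized_ring_carrier] using v_carrier by simp
qed

section \<open>Distinguished entries and linear independence\<close>

lemma cos_vec_last:
  assumes "q > 0"
  shows "cos_vec k q $ (q - 1) = 1"
proof -
  have "cos_vec k q $ (q - 1) = cos (2 * pi * real_of_int (int k))"
    using assms by (simp add: cos_vec_def of_nat_diff)
  then show ?thesis by (simp only: cos_int_2pin)
qed

lemma sin_vec_last:
  assumes "q > 0"
  shows "sin_vec k q $ (q - 1) = 0"
proof -
  have "sin_vec k q $ (q - 1) = sin (2 * pi * real_of_int (int k))"
    using assms by (simp add: sin_vec_def of_nat_diff)
  then show ?thesis by (simp only: sin_int_2pin)
qed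

text \<open>Index 0 carries the angle \<open>2 * pi * k / q\<close> because of the shifted
  numbering, and \<open>2 * k < q\<close> puts it strictly between 0 and \<pi>.\<close>

lemma sin_vec_first:
  assumes "0 < k" "2 * k < q"
  shows "sin_vec k q $ 0 \<noteq> 0"
proof -
  have "2 * real k < real q" using assms(2) by linarith
  then have "0 < 2 * pi * real k / real q" "2 * pi * real k / real q < pi"
    using assms by (auto simp: field_simps)
  then have "sin (2 * pi * real k / real q) > 0" by (rule sin_gt_zero)
  then show ?thesis using assms by (simp add: sin_vec_def)
qed

lemma indep_pairI:
  assumes vw: "v \<in> carrier_vec n" "w \<in> carrier_vec n"
    and i: "i < n" "v $ i \<noteq> 0" "w $ i = 0" and j: "j < n" "w $ j \<noteq> 0"
  shows "indep_pair n v w"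
proof -
  interpret vec_space "TYPE(real)" n .
  have ne: "v \<noteq> w" using i by auto
  have "lin_indpt {v, w}"
  proof (rule finite_lin_indpt2)
    fix a assume zero: "lincomb a {v, w} = 0\<^sub>v n"
    have entry: "a v * v $ l + a w * w $ l = 0" if "l < n" for l
      using lincomb_index[OF that, of "{v, w}" a] vw ne that by (simp add: zero)
    have "a v = 0" using entry[OF i(1)] i by simp
    moreover have "a w = 0" using entry[OF j(1)] j calculation by simp
    ultimately show "\<forall>x\<in>{v, w}. a x = 0" by simp
  qed (use vw in auto)
  then show ?thesis using ne by (simp add: indep_pair_def)
qed

text \<open>For \<open>k = 0\<close> the value \<open>ring_alpha\<close> is 2, and the expression
  under the root in \<open>ring_xi\<close> becomes the perfect square of
  \<open>p / r - \<beta>\<close>.\<close>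

lemma ring_xi_zero:
  assumes b: "b \<ge> 2" and q: "q > 0"
  shows "ring_xi b q 1 0 = sqrt (real b + 1) / sqrt (real b - 1)"
    and "ring_xi b q 2 0 = - (sqrt (real b - 1) ^ 3 / sqrt (real b + 1))"
proof -
  define p r where "p = sqrt (real b + 1)" and "r = sqrt (real b - 1)"
  define \<beta> where "\<beta> = ring_beta b q 0"
  have pr: "p > 0" "r > 0" "p * p = r * r + 2" "real b - 1 = r * r"
    using b by (auto simp: p_def r_def)
  have "2 * \<beta> = ring_alpha q 0 * (r / p) - p * r + p / r"
    unfolding \<beta>_def ring_beta_def sqrt_pred_succ real_sqrt_divide p_def r_def
    by (simp add: field_simps)
  then have beta: "2 * \<beta> = 2 * (r / p) - p * r + p / r"
    by (simp add: ring_alpha_def)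
  \<comment> \<open>This settles the sign of \<open>p / r - \<beta>\<close>, so that it is the
    nonnegative root.\<close>
  have "2 * (r * r) \<le> p * p + (p * p) * (r * r)"
    unfolding pr(3) using pr(2) by (simp add: algebra_simps add_nonneg_nonneg)
  then have "2 * (r / p) \<le> p / r + p * r"
    using pr(1,2) by (simp add: field_simps)
  then have nonneg: "0 \<le> p / r - \<beta>" using beta by linarith
  have "2 * \<beta> * (p / r) = 2 - p * p + (p / r) * (p / r)"
    unfolding beta using pr(1,2) by (simp add: field_simps)
  then have "(p / r - \<beta>)\<^sup>2 = \<beta>\<^sup>2 + (real b - 1)"
    unfolding pr(4) using pr(3) by (simp add: power2_eq_square algebra_simps)
  then have sqrt_eq: "sqrt (\<beta>\<^sup>2 + (real b - 1)) = p / r - \<beta>"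
    using nonneg by (rule real_sqrt_unique)
  show "ring_xi b q 1 0 = sqrt (real b + 1) / sqrt (real b - 1)"
    using sqrt_eq by (simp add: ring_xi_def \<beta>_def p_def r_def)
  have "ring_xi b q 2 0 = 2 * \<beta> - p / r"
    using sqrt_eq by (simp add: ring_xi_def \<beta>_def)
  also have "\<dots> = r * (2 - p * p) / p"
    unfolding beta using pr(1,2) by (simp add: field_simps)
  also have "\<dots> = - (r ^ 3 / p)"
    unfolding pr(3) by (simp add: power3_eq_cube)
  finally show "ring_xi b q 2 0 = - (sqrt (real b - 1) ^ 3 / sqrt (real b + 1))"
    by (simp add: p_def r_def)
qed

lemma smult_ring_evec:
  "c \<cdot>\<^sub>v ring_evec b q i k u =
    (c * ring_xi b q i k) \<cdot>\<^sub>v kron_vec u (e1 b) + c \<cdot>\<^sub>v kron_vec u (g1 b)"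
proof (rule eq_vecI)
  have dims: "dim_vec (e1 b) = b" "dim_vec (g1 b) = b"
    by (simp_all add: e1_def g1_def)
  fix l assume "l < dim_vec ((c * ring_xi b q i k) \<cdot>\<^sub>v kron_vec u (e1 b) + c \<cdot>\<^sub>v kron_vec u (g1 b))"
  then have l: "l < dim_vec u * b" by (simp add: dims)
  with div_mod_less[OF this]
  show "(c \<cdot>\<^sub>v ring_evec b q i k u) $ l =
      ((c * ring_xi b q i k) \<cdot>\<^sub>v kron_vec u (e1 b) + c \<cdot>\<^sub>v kron_vec u (g1 b)) $ l"
    by (simp add: ring_evec_def kron_vec_def dims algebra_simps)
qed (simp add: ring_evec_def e1_def g1_def)

lemma dim_trig_vec [simp]: "dim_vec (cos_vec k q) = q" "dim_vec (sin_vec k q) = q"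
  by (simp_all add: cos_vec_def sin_vec_def)

text \<open>Two non-corner vertices separate the vectors: in the last clique the sine vanishes and
  the cosine is 1, and in the first clique the sine is nonzero.\<close>

lemma indep_pair_ring_evec:
  assumes "b \<ge> 2" "0 < k" "2 * k < q"
  shows "indep_pair (b * q) (ring_evec b q i k (cos_vec k q)) (ring_evec b q i k (sin_vec k q))"
proof (rule indep_pairI)
  have entry: "r * b + 1 < b * q" "ring_evec b q i k u $ (r * b + 1) = u $ r"
    if "dim_vec u = q" "r < q" for u r
  proof -
    show idx: "r * b + 1 < b * q"
      using mult_add_less[OF that(2), of 1 b] assms(1) by (simp add: mult.commute)
    then show "ring_evec b q i k u $ (r * b + 1) = u $ r"
      unfolding ring_evec_def clique_vec_eq
      using that assms(1) div_mod_mult_add[of 1 b r]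
      by (simp add: kron_vec_def clique_vec_def mult.commute del: div_mod_mult_add)
  qed
  show "(q - 1) * b + 1 < b * q" "0 * b + 1 < b * q"
    using entry(1)[of "cos_vec k q" "q - 1"] entry(1)[of "cos_vec k q" 0] assms by simp_all
  show "ring_evec b q i k (cos_vec k q) $ ((q - 1) * b + 1) \<noteq> 0"
    using entry(2)[of "cos_vec k q" "q - 1"] cos_vec_last[of q k] assms by simp
  show "ring_evec b q i k (sin_vec k q) $ ((q - 1) * b + 1) = 0"
    using entry(2)[of "sin_vec k q" "q - 1"] sin_vec_last[of q k] assms by simp
  show "ring_evec b q i k (sin_vec k q) $ (0 * b + 1) \<noteq> 0"
    using entry(2)[of "sin_vec k q" 0] sin_vec_first[OF assms(2,3)] assms by simp
qed (simp_all add: carrier_vecI ring_evec_def clique_vec_eq)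

theorem theorem6:
  fixes b q :: nat and m :: "nat \<Rightarrow> nat" and A :: "real mat"
  assumes "b \<ge> 2" and "q \<ge> 3"
    and A_def: "A = normalized_adj (ring_adj b q)"
    and m_zero: "m 0 = 1"
    and m_mid: "\<And>k. k \<in> {1..nat \<lceil>real q / 2\<rceil> - 1} \<Longrightarrow> m k = 2"
    and m_half: "even q \<Longrightarrow> m (q div 2) = 1"
  shows
    "((\<forall>i\<in>{1, 2}. mult_of A (ring_lambda b q i 0) = added_mult b q m (ring_lambda b q i 0))
      \<and> eigenvector A
          (sqrt (real b + 1) \<cdot>\<^sub>v kron_vec (ones_vec q) (e1 b)
            + sqrt (real b - 1) \<cdot>\<^sub>v kron_vec (ones_vec q) (g1 b))
          (ring_lambda b q 1 0)
      \<and> eigenvector A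
          ((real b - 1) powr (3 / 2) \<cdot>\<^sub>v kron_vec (ones_vec q) (e1 b)
            - sqrt (real b + 1) \<cdot>\<^sub>v kron_vec (ones_vec q) (g1 b))
          (ring_lambda b q 2 0))
     \<and> (\<forall>k\<in>{1..nat \<lceil>real q / 2\<rceil> - 1}. \<forall>i\<in>{1, 2}.
          mult_of A (ring_lambda b q i k) = added_mult b q m (ring_lambda b q i k)
          \<and> eigenvector A (ring_evec b q i k (cos_vec k q)) (ring_lambda b q i k)
          \<and> eigenvector A (ring_evec b q i k (sin_vec k q)) (ring_lambda b q i k)
          \<and> indep_pair (b * q)
              (ring_evec b q i k (cos_vec k q)) (ring_evec b q i k (sin_vec k q)))
     \<and> (even q \<longrightarrow> (\<forall>i\<in>{1, 2}.
          mult_of A (ring_lambda b q i (q div 2)) = added_mult b q m (ring_lambda b q i (q div 2))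
          \<and> eigenvector A (ring_evec b q i (q div 2) (cos_vec (q div 2) q))
              (ring_lambda b q i (q div 2))))"
proof -
  note b = \<open>b \<ge> 2\<close> and q = \<open>q \<ge> 3\<close>
  have q_pos: "q > 0" using q by simp
  have mult: "mult_of A \<mu> = added_mult b q m \<mu>" for \<mu>
    unfolding A_def by (rule mult_of_ring[OF b q m_zero m_mid m_half])
  have cos_scaled: "eigenvector A (c \<cdot>\<^sub>v ring_evec b q i k (cos_vec k q)) (ring_lambda b q i k)"
    if "c \<noteq> 0" for c i k
    unfolding A_def
    using eigenvector_ring_evec[OF b q _ _ _ cycle_mat_cos_vec[OF q] that, where r = "q - 1"]
      cos_vec_last[OF q_pos] q by simp
  have cos_evec: "eigenvector A (ring_evec b q i k (cos_vec k q)) (ring_lambda b q i k)" for i k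
    using cos_scaled[of 1] by simp
  have mid: "0 < k" "2 * k < q" if "k \<in> {1..nat \<lceil>real q / 2\<rceil> - 1}" for k
    using that unfolding nat_ceiling_half by auto
  have sin_evec: "eigenvector A (ring_evec b q i k (sin_vec k q)) (ring_lambda b q i k)"
    if "k \<in> {1..nat \<lceil>real q / 2\<rceil> - 1}" for i k
    unfolding A_def
    using eigenvector_ring_evec[OF b q _ q_pos _ cycle_mat_sin_vec[OF q], of k 1 i]
      sin_vec_first[OF mid[OF that]] by simp
  have ones: "ones_vec q = cos_vec 0 q"
    by (rule eq_vecI) (simp_all add: ones_vec_def cos_vec_def)
  define p r where "p = sqrt (real b + 1)" and "r = sqrt (real b - 1)"
  have pr: "p > 0" "r > 0" using b by (auto simp: p_def r_def)
  \<comment> \<open>The stated vectors for \<open>k = 0\<close> are the generic ones scaled by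
    \<open>r\<close> and \<open>- p\<close>; these products are the resulting corner
    coefficients.\<close>
  have "r * ring_xi b q 1 0 = p" "- p * ring_xi b q 2 0 = r ^ 3"
    unfolding ring_xi_zero[OF b q_pos] using pr by (simp_all add: p_def r_def)
  moreover have "(real b - 1) powr (3 / 2) = r ^ 3"
  proof -
    have "(real b - 1) powr (3 / 2) = ((real b - 1) powr (1 / 2)) powr 3"
      by (simp only: powr_powr) simp
    also have "\<dots> = r ^ 3"
      using pr b by (simp add: powr_half_sqrt r_def)
    finally show ?thesis .
  qed
  ultimately have
    "sqrt (real b + 1) \<cdot>\<^sub>v kron_vec (ones_vec q) (e1 b)
        + sqrt (real b - 1) \<cdot>\<^sub>v kron_vec (ones_vec q) (g1 b) =
      r \<cdot>\<^sub>v ring_evec b q 1 0 (cos_vec 0 q)"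
    "(real b - 1) powr (3 / 2) \<cdot>\<^sub>v kron_vec (ones_vec q) (e1 b)
        - sqrt (real b + 1) \<cdot>\<^sub>v kron_vec (ones_vec q) (g1 b) =
      (- p) \<cdot>\<^sub>v ring_evec b q 2 0 (cos_vec 0 q)"
    unfolding smult_ring_evec ones p_def[symmetric] r_def[symmetric]
    by (auto simp: e1_def g1_def)
  then have
    "eigenvector A (sqrt (real b + 1) \<cdot>\<^sub>v kron_vec (ones_vec q) (e1 b)
      + sqrt (real b - 1) \<cdot>\<^sub>v kron_vec (ones_vec q) (g1 b)) (ring_lambda b q 1 0)"
    "eigenvector A ((real b - 1) powr (3 / 2) \<cdot>\<^sub>v kron_vec (ones_vec q) (e1 b)
      - sqrt (real b + 1) \<cdot>\<^sub>v kron_vec (ones_vec q) (g1 b)) (ring_lambda b q 2 0)"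
    using cos_scaled[of r 1 0] cos_scaled[of "- p" 2 0] pr by simp_all
  then show ?thesis
    using mult cos_evec sin_evec indep_pair_ring_evec[OF b mid] by blast
qed

end
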